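(* For all positive integers $n,m$ we have $s_{n,m}=k_{n,m}$.
   Context: RK puzzles: for a positive integer $n$ let $I_n=\{1,\dots,n\}$ and $I_{n,m}=I_n\times I_m\subset\mathbb{R}^2$ (first coordinate horizontal). For a slope $s\in\mathbb{Q}\cup\{\infty\}$ let $\mathscr{L}_s$ be the set of lines of slope $s$ meeting $I_{n,m}$, and for $\ell\in\mathscr{L}_s$ let $P_{\ell,s}(X)=\sum_{(i,j)\in\ell\cap I_{n,m}}X_{i,j}$. An $n\times m$ RK puzzle with finite slope set $T$ is a system consisting of one equation $P_{\ell,t}(X)=c_{\ell,t}$ (arbitrary $c_{\ell,t}\in\mathbb{R}$) for each $t\in T$, $\ell\in\mathscr{L}_t$; solutions are real solutions; solvable means having a solution. A set of entries $X_{i,j}$ is uniquely solvable if all solutions agree on each of them. Slope order: $S=\mathbb{Z}\cup\{1/k:k\in\mathbb{Z}\}$ with $1/0:=\infty$, totally ordered by $0\prec\infty\prec-1\prec1\prec-\frac12\prec-2\prec\frac12\prec2\prec-\frac13\prec-3\prec\frac13\prec3\prec\cdots$ (after $0,\infty,-1,1$, for each $k=2,3,\dots$ in turn come $-\frac1k\prec-k\prec\frac1k\prec k$). For $s\in S$, $\mathrm{RK}^s_{n,m}$ is the family of all solvable $n\times m$ RK puzzles with slope set $\{t\in S:t\preceq s\}$. Rows and columns: the $j$-th row of $I_{n,m}$ is $I_n\times\{j\}$, the first and last rows being $j=1$ and $j=m$; the $i$-th column is $\{i\}\times I_m$, the first and last columns being $i=1$ and $i=n$. Invariants: $k_{n,m}$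 is the smallest $s\in S$ (w.r.t. $\prec$) such that every RK puzzle in $\mathrm{RK}^s_{n,m}$ has a unique solution. $r_{n,m}$ (resp. $c_{n,m}$) is the smallest $s\in S$ such that for every RK puzzle in $\mathrm{RK}^{s}_{n,m}$, the first row or the last row (resp. the first column or the last column) is uniquely solvable; $s_{n,m}=\min\{r_{n,m},c_{n,m}\}$ with respect to $\prec$. *)

theory Defs
  imports Complex_Main "HOL-Library.FuncSet"
begin

section \<open>Slopes and their order\<close>

datatype slope = Slope rat | Vertical

fun recip_slope :: "int \<Rightarrow> slope" where
  "recip_slope k = (if k = 0 then Vertical else Slope (1 / of_int k))"

definition std_slopes :: "slope set" where
  "std_slopes = range (\<lambda>k::int. Slope (of_int k)) \<union> range recip_slope"

text \<open>
  The sequence \<open>0, \<infinity>, -1, 1, -1/2, -2, 1/2, 2, -1/3, -3, 1/3, 3, \<dots>\<close>: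
  from index 4 on, the block of indices \<open>4(k-1), \<dots>, 4(k-1)+3\<close>
  holds \<open>-1/k, -k, 1/k, k\<close>.
\<close>

definition slope_enum :: "nat \<Rightarrow> slope" where
  "slope_enum i =
    (if i = 0 then Slope 0
     else if i = 1 then Vertical
     else if i = 2 then Slope (- 1)
     else if i = 3 then Slope 1
     else let k = of_nat (i div 4 + 1) in
       (if i mod 4 = 0 then Slope (- 1 / k)
        else if i mod 4 = 1 then Slope (- k)
        else if i mod 4 = 2 then Slope (1 / k)
        else Slope k))"

definition slope_le :: "slope \<Rightarrow> slope \<Rightarrow> bool" (infix "\<preceq>" 50) where
  "s \<preceq> t \<longleftrightarrow> (\<exists>i j. i \<le> j \<and> s = slope_enum i \<and> t = slope_enum j)"

definition least_slope :: "(slope \<Rightarrow> bool) \<Rightarrow> slope" where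
  "least_slope P = (THE s. s \<in> std_slopes \<and> P s \<and> (\<forall>t\<in>std_slopes. P t \<longrightarrow> s \<preceq> t))"

definition min_slope :: "slope \<Rightarrow> slope \<Rightarrow> slope" where
  "min_slope s t = (if s \<preceq> t then s else t)"


section \<open>Puzzles\<close>

definition grid :: "nat \<Rightarrow> nat \<Rightarrow> (nat \<times> nat) set" where
  "grid n m = {1..n} \<times> {1..m}"

definition pt :: "nat \<times> nat \<Rightarrow> real \<times> real" where
  "pt p = (real (fst p), real (snd p))"

fun lines_of_slope :: "slope \<Rightarrow> (real \<times> real) set set" where
  "lines_of_slope (Slope q) = range (\<lambda>b. {(x, y). y = of_rat q * x + b})"
| "lines_of_slope Vertical = range (\<lambda>a. {(x, y). x = a})"

definition grid_lines :: "nat \<Rightarrow> nat \<Rightarrow> slope \<Rightarrow> (real \<times> real) set set" where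
  "grid_lines n m s = {l \<in> lines_of_slope s. \<exists>p \<in> grid n m. pt p \<in> l}"

definition line_sum :: "nat \<Rightarrow> nat \<Rightarrow> (real \<times> real) set \<Rightarrow> (nat \<times> nat \<Rightarrow> real) \<Rightarrow> real" where
  "line_sum n m l X = (\<Sum>p | p \<in> grid n m \<and> pt p \<in> l. X p)"

text \<open>
  A puzzle is given by its finite slope set and the right-hand sides of its equations.
  Values of the right-hand side outside the slope set and \<^const>\<open>grid_lines\<close> play no role.
\<close>

type_synonym puzzle = "slope set \<times> (slope \<Rightarrow> (real \<times> real) set \<Rightarrow> real)"

definition solutions :: "nat \<Rightarrow> nat \<Rightarrow> puzzle \<Rightarrow> (nat \<times> nat \<Rightarrow> real) set" where
  "solutions n m Q = {X \<in> grid n m \<rightarrow>\<^sub>E UNIV.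
     \<forall>t \<in> fst Q. \<forall>l \<in> grid_lines n m t. line_sum n m l X = snd Q t l}"

definition solvable :: "nat \<Rightarrow> nat \<Rightarrow> puzzle \<Rightarrow> bool" where
  "solvable n m Q \<longleftrightarrow> (\<exists>X. X \<in> solutions n m Q)"

definition uniquely_solvable_on :: "nat \<Rightarrow> nat \<Rightarrow> puzzle \<Rightarrow> (nat \<times> nat) set \<Rightarrow> bool" where
  "uniquely_solvable_on n m Q A \<longleftrightarrow>
     (\<forall>X \<in> solutions n m Q. \<forall>Y \<in> solutions n m Q. \<forall>p \<in> A. X p = Y p)"

definition RK :: "nat \<Rightarrow> nat \<Rightarrow> slope \<Rightarrow> puzzle set" where
  "RK n m s = {Q. fst Q = {t \<in> std_slopes. t \<preceq> s} \<and> solvable n m Q}"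


section \<open>Invariants\<close>

definition row :: "nat \<Rightarrow> nat \<Rightarrow> (nat \<times> nat) set" where
  "row n j = {1..n} \<times> {j}"

definition column :: "nat \<Rightarrow> nat \<Rightarrow> (nat \<times> nat) set" where
  "column m i = {i} \<times> {1..m}"

definition k_inv :: "nat \<Rightarrow> nat \<Rightarrow> slope" where
  "k_inv n m = least_slope (\<lambda>s. \<forall>Q \<in> RK n m s. \<exists>!X. X \<in> solutions n m Q)"

definition r_inv :: "nat \<Rightarrow> nat \<Rightarrow> slope" where
  "r_inv n m = least_slope (\<lambda>s. \<forall>Q \<in> RK n m s.
     uniquely_solvable_on n m Q (row n 1) \<or> uniquely_solvable_on n m Q (row n m))"

definition c_inv :: "nat \<Rightarrow> nat \<Rightarrow> slope" where
  "c_inv n m = least_slope (\<lambda>s. \<forall>Q \<in> RK n m s.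
     uniquely_solvable_on n m Q (column m 1) \<or> uniquely_solvable_on n m Q (column m n))"

definition s_inv :: "nat \<Rightarrow> nat \<Rightarrow> slope" where
  "s_inv n m = min_slope (r_inv n m) (c_inv n m)"


section \<open>The order and the invariants are well defined\<close>

lemma slope_enum_block:
  assumes "k \<ge> 2" "r < 4"
  shows "slope_enum (4 * (k - 1) + r) =
    (if r = 0 then Slope (- 1 / of_nat k) else if r = 1 then Slope (- of_nat k)
     else if r = 2 then Slope (1 / of_nat k) else Slope (of_nat k))"
proof -
  define i where "i = 4 * (k - 1) + r"
  have "i div 4 + 1 = k" "i mod 4 = r" "i \<ge> 4"
    using assms by (auto simp: i_def)
  then have "slope_enum i =
    (if r = 0 then Slope (- 1 / of_nat k) else if r = 1 then Slope (- of_nat k)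
     else if r = 2 then Slope (1 / of_nat k) else Slope (of_nat k))"
    unfolding slope_enum_def Let_def by auto
  then show ?thesis by (simp add: i_def)
qed

lemma slope_enum_cases:
  fixes i :: nat
  obtains "i = 0" | "i = 1" | "i = 2" | "i = 3"
  | k r where "k \<ge> 2" "r < 4" "i = 4 * (k - 1) + r"
proof (cases "i < 4")
  case True
  then have "i = 0 \<or> i = 1 \<or> i = 2 \<or> i = 3" by auto
  with that show thesis by blast
next
  case False
  then show thesis
    using that(5)[of "i div 4 + 1" "i mod 4"] by auto
qed

definition slope_index :: "slope \<Rightarrow> nat" where
  "slope_index s = (case s of Vertical \<Rightarrow> 1 | Slope q \<Rightarrow>
     if q = 0 then 0 else if q = - 1 then 2 else if q = 1 then 3
     else if \<bar>q\<bar> < 1 then 4 * (nat \<lfloor>1 / \<bar>q\<bar>\<rfloor> - 1) + (if q < 0 then 0 else 2)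
     else 4 * (nat \<lfloor>\<bar>q\<bar>\<rfloor> - 1) + (if q < 0 then 1 else 3))"

lemma slope_index_enum: "slope_index (slope_enum i) = i"
proof (cases i rule: slope_enum_cases)
  case (5 k r)
  define q :: rat where "q = 1 / of_nat k"
  have k: "(of_nat k :: rat) > 1" using 5(1) by simp
  then have q: "q > 0" "q < 1" and kq: "1 / q = of_nat k"
    by (auto simp: q_def)
  have "slope_enum i = (if r = 0 then Slope (- q) else if r = 1 then Slope (- of_nat k)
     else if r = 2 then Slope q else Slope (of_nat k))"
    unfolding 5(3) slope_enum_block[OF 5(1,2)] by (simp add: q_def)
  moreover have "r = 0 \<or> r = 1 \<or> r = 2 \<or> r = 3" using 5(2) by auto
  ultimately show ?thesis
    using k q kq 5(3) by (elim disjE) (simp_all add: slope_index_def)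
qed (auto simp: slope_enum_def slope_index_def)

lemma inj_slope_enum: "inj slope_enum"
  by (metis injI slope_index_enum)

lemma range_slope_enum: "range slope_enum = std_slopes"
proof (intro equalityI subsetI)
  fix s assume "s \<in> range slope_enum"
  then obtain i where i: "s = slope_enum i" by blast
  have int: "Slope (of_int k) \<in> std_slopes" for k :: int
    by (auto simp: std_slopes_def)
  have rec: "Slope (1 / of_int k) \<in> std_slopes" if "k \<noteq> 0" for k :: int
    unfolding std_slopes_def using that by (intro UnI2 image_eqI[of _ _ k]) auto
  have vert: "Vertical \<in> std_slopes"
    unfolding std_slopes_def by (intro UnI2 image_eqI[of _ _ 0]) auto
  show "s \<in> std_slopes"
  proof (cases i rule: slope_enum_cases)
    case (5 k r)
    then show ?thesis
      using i slope_enum_block[OF 5(1,2)] int[of "int k"] int[of "- int k"]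
        rec[of "int k"] rec[of "- int k"] by auto
  qed (use i int[of 0] int[of 1] int[of "-1"] vert in \<open>auto simp: slope_enum_def\<close>)
next
  fix s assume s: "s \<in> std_slopes"
  have small: "Slope 0 \<in> range slope_enum" "Vertical \<in> range slope_enum"
    "Slope (-1) \<in> range slope_enum" "Slope 1 \<in> range slope_enum"
    using rangeI[of slope_enum 0] rangeI[of slope_enum 1] rangeI[of slope_enum 2]
      rangeI[of slope_enum 3] by (auto simp: slope_enum_def)
  have block: "Slope (- 1 / of_nat k) \<in> range slope_enum" "Slope (- of_nat k) \<in> range slope_enum"
    "Slope (1 / of_nat k) \<in> range slope_enum" "Slope (of_nat k) \<in> range slope_enum"
    if k: "k \<ge> 2" for k
  proof -
    have *: "s \<in> range slope_enum" if "slope_enum i = s" for s i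
      using that by blast
    show "Slope (- 1 / of_nat k) \<in> range slope_enum"
      by (rule *[OF trans[OF slope_enum_block[OF k, of 0]]]) simp_all
    show "Slope (- of_nat k) \<in> range slope_enum"
      by (rule *[OF trans[OF slope_enum_block[OF k, of 1]]]) simp_all
    show "Slope (1 / of_nat k) \<in> range slope_enum"
      by (rule *[OF trans[OF slope_enum_block[OF k, of 2]]]) simp_all
    show "Slope (of_nat k) \<in> range slope_enum"
      by (rule *[OF trans[OF slope_enum_block[OF k, of 3]]]) simp_all
  qed
  from s consider k where "s = Slope (of_int k)" | k where "s = recip_slope k"
    unfolding std_slopes_def by blast
  then show "s \<in> range slope_enum"
  proof cases
    case (1 k)
    consider "k = 0" | "k = 1" | "k = -1" | "nat k \<ge> 2" | "nat (- k) \<ge> 2"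
      by linarith
    then show ?thesis
      by cases (use 1 small block(4)[of "nat k"] block(2)[of "nat (- k)"] in
          \<open>simp_all add: of_nat_nat\<close>)
  next
    case (2 k)
    consider "k = 0" | "k = 1" | "k = -1" | "nat k \<ge> 2" | "nat (- k) \<ge> 2"
      by linarith
    then show ?thesis
      by cases (use 2 small block(3)[of "nat k"] block(1)[of "nat (- k)"] in
          \<open>simp_all add: of_nat_nat\<close>)
  qed
qed

lemma slope_enum_le_iff [simp]: "slope_enum i \<preceq> slope_enum j \<longleftrightarrow> i \<le> j"
  unfolding slope_le_def by (metis slope_index_enum)

lemma least_slope_works:
  assumes "s \<in> std_slopes" "P s"
  shows "least_slope P \<in> std_slopes" "P (least_slope P)"
    "\<And>t. t \<in> std_slopes \<Longrightarrow> P t \<Longrightarrow> least_slope P \<preceq> t"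
proof -
  let ?i = "LEAST i. P (slope_enum i)"
  obtain i where "P (slope_enum i)"
    using assms range_slope_enum by (metis imageE)
  then have P: "P (slope_enum ?i)" by (rule LeastI)
  have le: "\<forall>t\<in>std_slopes. P t \<longrightarrow> slope_enum ?i \<preceq> t"
    unfolding range_slope_enum[symmetric] by (auto intro: Least_le)
  have "least_slope P = slope_enum ?i"
    unfolding least_slope_def
  proof (rule the_equality)
    show "slope_enum ?i \<in> std_slopes \<and> P (slope_enum ?i)
        \<and> (\<forall>t\<in>std_slopes. P t \<longrightarrow> slope_enum ?i \<preceq> t)"
      using P le range_slope_enum by blast
  next
    fix s assume *: "s \<in> std_slopes \<and> P s \<and> (\<forall>t\<in>std_slopes. P t \<longrightarrow> s \<preceq> t)"
    then obtain j where j: "s = slope_enum j" using range_slope_enum by blast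
    have "j \<le> ?i" using * P range_slope_enum j by (metis rangeI slope_enum_le_iff)
    moreover have "?i \<le> j" using * le j by (metis slope_enum_le_iff)
    ultimately show "s = slope_enum ?i" using j by simp
  qed
  then show "least_slope P \<in> std_slopes" "P (least_slope P)"
    "\<And>t. t \<in> std_slopes \<Longrightarrow> P t \<Longrightarrow> least_slope P \<preceq> t"
    using P le range_slope_enum by auto
qed

lemma ex_uniquely_solvable_slope:
  "\<exists>s \<in> std_slopes. \<forall>Q \<in> RK n m s. uniquely_solvable_on n m Q (grid n m)"
proof -
  define s where "s = recip_slope (int (n + 1))"
  have s: "s \<in> std_slopes" by (simp only: s_def std_slopes_def UnI2 rangeI)
  obtain i where i: "s = slope_enum i" using s range_slope_enum by blast
  have refl: "s \<preceq> s" using i by simp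
  have "uniquely_solvable_on n m Q (grid n m)" if Q: "Q \<in> RK n m s" for Q
    unfolding uniquely_solvable_on_def
  proof (intro ballI)
    fix X Y p
    assume X: "X \<in> solutions n m Q" and Y: "Y \<in> solutions n m Q" and p: "p \<in> grid n m"
    obtain a b where ab: "p = (a, b)" by fastforce
    define q :: rat where "q = 1 / of_nat (n + 1)"
    have sq: "s = Slope q" by (simp add: s_def q_def)
    have q: "(of_rat q :: real) = 1 / real (n + 1)"
      by (simp add: q_def of_rat_divide of_rat_add)
    define l :: "(real \<times> real) set"
      where "l = {(x, y). y = of_rat q * x + (real b - of_rat q * real a)}"
    have l: "l \<in> grid_lines n m s"
      using p ab unfolding grid_lines_def sq l_def by (auto simp: pt_def intro!: bexI[of _ p])
    have "{p'. p' \<in> grid n m \<and> pt p' \<in> l} = {p}"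
    proof (intro equalityI subsetI)
      fix p' assume "p' \<in> {p'. p' \<in> grid n m \<and> pt p' \<in> l}"
      then obtain a' b' where p': "p' = (a', b')" "a' \<in> {1..n}" "b' \<in> {1..m}"
        "real b' = of_rat q * real a' + (real b - of_rat q * real a)"
        by (auto simp: grid_def pt_def l_def)
      have "real (n + 1) * (real b' - real b) = real a' - real a"
      proof -
        have "real b' - real b = (real a' - real a) / real (n + 1)"
          using p'(4) unfolding q by (simp add: diff_divide_distrib)
        then show ?thesis by (simp del: of_nat_add)
      qed
      then have "of_int (int (n + 1) * (int b' - int b)) = (of_int (int a' - int a) :: real)"
        by simp
      then have eq: "int (n + 1) * (int b' - int b) = int a' - int a"
        by (simp only: of_int_eq_iff)
      have "\<bar>int a' - int a\<bar> < int (n + 1)"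
        using p'(2) p ab by (auto simp: grid_def)
      then have "int b' - int b = 0"
        using eq by (metis abs_ge_zero dvd_imp_le_int dvd_triv_left leD abs_of_nat
            mult_eq_0_iff of_nat_eq_0_iff Suc_eq_plus1 nat.distinct(1))
      then show "p' \<in> {p}" using eq p' ab by auto
    qed (use p l in \<open>auto simp: l_def pt_def ab\<close>)
    then have ls: "line_sum n m l Z = Z p" for Z
      by (simp add: line_sum_def)
    have "s \<in> fst Q" using Q s refl by (simp add: RK_def)
    then show "X p = Y p"
      using X Y l ls by (fastforce simp: solutions_def)
  qed
  then show ?thesis using s by blast
qed

lemma ex1_solution_iff:
  "(\<exists>!X. X \<in> solutions n m Q) \<longleftrightarrow> solvable n m Q \<and> uniquely_solvable_on n m Q (grid n m)"
proof -
  have "X = Y" if "X \<in> solutions n m Q" "Y \<in> solutions n m Q"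
    "\<And>p. p \<in> grid n m \<Longrightarrow> X p = Y p" for X Y
    using that by (intro PiE_ext[of X "grid n m" "\<lambda>_. UNIV" Y]) (auto simp: solutions_def)
  then show ?thesis
    unfolding solvable_def uniquely_solvable_on_def by blast
qed

lemma invariants_exist:
  assumes "n \<ge> 1" "m \<ge> 1"
  shows "\<exists>s\<in>std_slopes. \<forall>Q \<in> RK n m s. \<exists>!X. X \<in> solutions n m Q"
    and "\<exists>s\<in>std_slopes. \<forall>Q \<in> RK n m s.
      uniquely_solvable_on n m Q (row n 1) \<or> uniquely_solvable_on n m Q (row n m)"
    and "\<exists>s\<in>std_slopes. \<forall>Q \<in> RK n m s.
      uniquely_solvable_on n m Q (column m 1) \<or> uniquely_solvable_on n m Q (column m n)"
proof -
  obtain s where s: "s \<in> std_slopes"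
    and u: "\<forall>Q \<in> RK n m s. uniquely_solvable_on n m Q (grid n m)"
    using ex_uniquely_solvable_slope by blast
  have sub: "row n 1 \<subseteq> grid n m" "column m 1 \<subseteq> grid n m"
    using assms by (auto simp: row_def column_def grid_def)
  have mono: "uniquely_solvable_on n m Q A"
    if "uniquely_solvable_on n m Q (grid n m)" "A \<subseteq> grid n m" for Q A
    using that unfolding uniquely_solvable_on_def by blast
  show "\<exists>s\<in>std_slopes. \<forall>Q \<in> RK n m s. \<exists>!X. X \<in> solutions n m Q"
  proof (intro bexI[OF _ s] ballI)
    fix Q assume Q: "Q \<in> RK n m s"
    then have "solvable n m Q" by (simp add: RK_def)
    with u Q show "\<exists>!X. X \<in> solutions n m Q"
      unfolding ex1_solution_iff by blast
  qed
  show "\<exists>s\<in>std_slopes. \<forall>Q \<in> RK n m s.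
      uniquely_solvable_on n m Q (row n 1) \<or> uniquely_solvable_on n m Q (row n m)"
    using s u mono sub(1) by blast
  show "\<exists>s\<in>std_slopes. \<forall>Q \<in> RK n m s.
      uniquely_solvable_on n m Q (column m 1) \<or> uniquely_solvable_on n m Q (column m n)"
    using s u mono sub(2) by blast
qed

end

theory Submission imports Defs "HOL-Library.Product_Plus" begin

text \<open>
  The difference of two solutions solves the homogeneous system, and the homogeneous system is
  invariant under translations that keep the support inside the grid. A nonzero homogeneous
  solution can therefore be pushed until its support touches any prescribed side of the grid. So if
  some puzzle has several solutions, it has several solutions on each of the four sides, and
  \<open>r\<close>, \<open>c\<close> and \<open>k\<close> all coincide.
\<close>

text \<open>All lines of a slope are quantified over, not only those meeting the grid. A line that
  misses the grid contributes an empty sum, so the system is the same, and the class of lines is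
  closed under translation.\<close>

definition homogeneous :: "nat \<Rightarrow> nat \<Rightarrow> slope set \<Rightarrow> (nat \<times> nat \<Rightarrow> real) \<Rightarrow> bool" where
  "homogeneous n m T Z \<longleftrightarrow> (\<forall>t\<in>T. \<forall>l\<in>lines_of_slope t. line_sum n m l Z = 0)"

lemma finite_grid: "finite (grid n m)"
  by (simp add: grid_def)

text \<open>The sum of a shifted function along \<open>l\<close> is the sum of the original along
  the preimage of \<open>l\<close> under the shift; this keeps the preimage in the same parallel
  class.\<close>

lemma lines_of_slope_translate:
  assumes "l \<in> lines_of_slope t"
  shows "{x. x + w \<in> l} \<in> lines_of_slope t"
proof -
  obtain u v where w: "w = (u, v)" by fastforce
  show ?thesis
  proof (cases t)
    case (Slope q)
    then obtain b where "l = {(x, y). y = of_rat q * x + b}" using assms by auto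
    then have "{x. x + w \<in> l} = {(x, y). y = of_rat q * x + (b + of_rat q * u - v)}"
      by (auto simp: w algebra_simps)
    then show ?thesis using Slope by auto
  next
    case Vertical
    then obtain a where "l = {(x, y). x = a}" using assms by auto
    then have "{x. x + w \<in> l} = {(x, y). x = a - u}"
      by (auto simp: w)
    then show ?thesis using Vertical by auto
  qed
qed

text \<open>Only the support is known to stay inside the grid under a shift, so line sums are
  compared over supports.\<close>

lemma line_sum_support:
  "line_sum n m l Z = (\<Sum>p | p \<in> grid n m \<and> Z p \<noteq> 0 \<and> pt p \<in> l. Z p)"
  unfolding line_sum_def
  by (rule sum.mono_neutral_right) (auto intro: finite_subset[OF _ finite_grid[of n m]])

text \<open>Pushing \<open>Z\<close> forward along the shift turns its sum along a line into the sum
  along a parallel line, which vanishes. The vector \<open>w\<close> is real and may be negative,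
  while \<open>\<tau>\<close> acts on naturals and has to agree with the shift only on the
  support.\<close>

lemma homogeneous_translate:
  assumes Z: "homogeneous n m T Z"
    and grid: "\<And>p. p \<in> grid n m \<Longrightarrow> Z p \<noteq> 0 \<Longrightarrow> \<tau> p \<in> grid n m"
    and \<tau>: "\<And>p. p \<in> grid n m \<Longrightarrow> Z p \<noteq> 0 \<Longrightarrow> pt (\<tau> p) = pt p + w"
  obtains Z' where "homogeneous n m T Z'"
    "\<And>p. p \<in> grid n m \<Longrightarrow> Z p \<noteq> 0 \<Longrightarrow> Z' (\<tau> p) = Z p"
proof -
  define A where "A = {p \<in> grid n m. Z p \<noteq> 0}"
  \<comment> \<open>Push-forward of \<open>Z\<close>, extended by 0 off the shifted support; the
    injectivity shown next makes \<open>inv_into\<close> recover the original point.\<close>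
  define Z' where "Z' q = (if q \<in> \<tau> ` A then Z (inv_into A \<tau> q) else 0)" for q
  have inj: "inj_on \<tau> A"
  proof (rule inj_onI)
    fix p q assume "p \<in> A" "q \<in> A" "\<tau> p = \<tau> q"
    then have "pt p + w = pt q + w" using \<tau> by (metis (mono_tags, lifting) A_def mem_Collect_eq)
    then show "p = q" by (simp add: pt_def prod_eq_iff)
  qed
  then have Z': "Z' (\<tau> p) = Z p" if "p \<in> A" for p
    using that by (simp add: Z'_def)
  have "line_sum n m l Z' = line_sum n m {x. x + w \<in> l} Z" for l
  proof -
    have "{q. q \<in> grid n m \<and> Z' q \<noteq> 0 \<and> pt q \<in> l} = \<tau> ` {p \<in> A. pt p + w \<in> l}" (is "?L = ?R")
    proof
      show "?L \<subseteq> ?R"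
      proof
        fix q assume q: "q \<in> ?L"
        then obtain p where "p \<in> A" "q = \<tau> p" by (auto simp: Z'_def split: if_splits)
        then show "q \<in> ?R" using q \<tau>[of p] by (auto simp: A_def)
      qed
      show "?R \<subseteq> ?L" using Z' grid \<tau> by (auto simp: A_def)
    qed
    then have "line_sum n m l Z' = (\<Sum>p | p \<in> A \<and> pt p + w \<in> l. Z' (\<tau> p))"
      unfolding line_sum_support[of n m l Z']
      by (simp add: sum.reindex[OF inj_on_subset[OF inj]])
    also have "\<dots> = (\<Sum>p | p \<in> A \<and> pt p + w \<in> l. Z p)"
      by (intro sum.cong) (auto simp: Z')
    also have "\<dots> = line_sum n m {x. x + w \<in> l} Z"
      unfolding line_sum_support by (simp add: A_def conj_assoc)
    finally show ?thesis .
  qed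
  then have "homogeneous n m T Z'"
    using Z lines_of_slope_translate by (simp add: homogeneous_def)
  then show thesis using Z' that by (auto simp: A_def)
qed

text \<open>Take a support point with least second coordinate and shift until it has coordinate 1;
  minimality keeps the rest of the support in the grid.\<close>

lemma homogeneous_first_row:
  assumes "homogeneous n m T Z" "p0 \<in> grid n m" "Z p0 \<noteq> 0"
  shows "\<exists>Z'. homogeneous n m T Z' \<and> (\<exists>p\<in>row n 1. Z' p \<noteq> 0)"
proof -
  define A where "A = {p \<in> grid n m. Z p \<noteq> 0}"
  have fin: "finite (snd ` A)" and ne: "snd ` A \<noteq> {}"
    using assms finite_grid[of n m] by (cases p0; auto simp: A_def)+
  obtain p where p: "p \<in> A" "snd p = Min (snd ` A)" using Min_in[OF fin ne] by force
  have le: "snd p \<le> snd q" if "q \<in> A" for q using p fin that by simp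
  \<comment> \<open>The truncated subtraction is exact on the support: there \<open>snd q\<close> is
    at least \<open>snd p\<close>, which is at least 1.\<close>
  define \<tau> where "\<tau> q = (fst q, snd q - (snd p - 1))" for q :: "nat \<times> nat"
  obtain Z' where Z': "homogeneous n m T Z'" "\<And>q. q \<in> A \<Longrightarrow> Z' (\<tau> q) = Z q"
  proof (rule homogeneous_translate[OF assms(1), of \<tau> "(0, - real (snd p - 1))"])
    fix q assume "q \<in> grid n m" "Z q \<noteq> 0"
    then show "\<tau> q \<in> grid n m" "pt (\<tau> q) = pt q + (0, - real (snd p - 1))"
      using le[of q] p(1) by (auto simp: A_def \<tau>_def grid_def pt_def)
  qed (auto simp: A_def)
  moreover have "\<tau> p \<in> row n 1" using p by (auto simp: A_def \<tau>_def grid_def row_def)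
  moreover have "Z p \<noteq> 0" using p by (simp add: A_def)
  ultimately show ?thesis using p by metis
qed

text \<open>Now a support point with greatest second coordinate is shifted up to \<open>m\<close>;
  maximality bounds the others.\<close>

lemma homogeneous_last_row:
  assumes "homogeneous n m T Z" "p0 \<in> grid n m" "Z p0 \<noteq> 0"
  shows "\<exists>Z'. homogeneous n m T Z' \<and> (\<exists>p\<in>row n m. Z' p \<noteq> 0)"
proof -
  define A where "A = {p \<in> grid n m. Z p \<noteq> 0}"
  have fin: "finite (snd ` A)" and ne: "snd ` A \<noteq> {}"
    using assms finite_grid[of n m] by (cases p0; auto simp: A_def)+
  obtain p where p: "p \<in> A" "snd p = Max (snd ` A)" using Max_in[OF fin ne] by force
  have le: "snd q \<le> snd p" if "q \<in> A" for q using p fin that by simp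
  define \<tau> where "\<tau> q = (fst q, snd q + (m - snd p))" for q :: "nat \<times> nat"
  obtain Z' where Z': "homogeneous n m T Z'" "\<And>q. q \<in> A \<Longrightarrow> Z' (\<tau> q) = Z q"
  proof (rule homogeneous_translate[OF assms(1), of \<tau> "(0, real (m - snd p))"])
    fix q assume "q \<in> grid n m" "Z q \<noteq> 0"
    then show "\<tau> q \<in> grid n m" "pt (\<tau> q) = pt q + (0, real (m - snd p))"
      using le[of q] p(1) by (auto simp: A_def \<tau>_def grid_def pt_def)
  qed (auto simp: A_def)
  moreover have "\<tau> p \<in> row n m" using p by (auto simp: A_def \<tau>_def grid_def row_def)
  moreover have "Z p \<noteq> 0" using p by (simp add: A_def)
  ultimately show ?thesis using p by metis
qed

text \<open>The first-row argument with the coordinates exchanged.\<close>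

lemma homogeneous_first_column:
  assumes "homogeneous n m T Z" "p0 \<in> grid n m" "Z p0 \<noteq> 0"
  shows "\<exists>Z'. homogeneous n m T Z' \<and> (\<exists>p\<in>column m 1. Z' p \<noteq> 0)"
proof -
  define A where "A = {p \<in> grid n m. Z p \<noteq> 0}"
  have fin: "finite (fst ` A)" and ne: "fst ` A \<noteq> {}"
    using assms finite_grid[of n m] by (cases p0; auto simp: A_def)+
  obtain p where p: "p \<in> A" "fst p = Min (fst ` A)" using Min_in[OF fin ne] by force
  have le: "fst p \<le> fst q" if "q \<in> A" for q using p fin that by simp
  define \<tau> where "\<tau> q = (fst q - (fst p - 1), snd q)" for q :: "nat \<times> nat"
  obtain Z' where Z': "homogeneous n m T Z'" "\<And>q. q \<in> A \<Longrightarrow> Z' (\<tau> q) = Z q"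
  proof (rule homogeneous_translate[OF assms(1), of \<tau> "(- real (fst p - 1), 0)"])
    fix q assume "q \<in> grid n m" "Z q \<noteq> 0"
    then show "\<tau> q \<in> grid n m" "pt (\<tau> q) = pt q + (- real (fst p - 1), 0)"
      using le[of q] p(1) by (auto simp: A_def \<tau>_def grid_def pt_def)
  qed (auto simp: A_def)
  moreover have "\<tau> p \<in> column m 1" using p by (auto simp: A_def \<tau>_def grid_def column_def)
  moreover have "Z p \<noteq> 0" using p by (simp add: A_def)
  ultimately show ?thesis using p by metis
qed

text \<open>The last-row argument with the coordinates exchanged.\<close>

lemma homogeneous_last_column:
  assumes "homogeneous n m T Z" "p0 \<in> grid n m" "Z p0 \<noteq> 0"
  shows "\<exists>Z'. homogeneous n m T Z' \<and> (\<exists>p\<in>column m n. Z' p \<noteq> 0)"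
proof -
  define A where "A = {p \<in> grid n m. Z p \<noteq> 0}"
  have fin: "finite (fst ` A)" and ne: "fst ` A \<noteq> {}"
    using assms finite_grid[of n m] by (cases p0; auto simp: A_def)+
  obtain p where p: "p \<in> A" "fst p = Max (fst ` A)" using Max_in[OF fin ne] by force
  have le: "fst q \<le> fst p" if "q \<in> A" for q using p fin that by simp
  define \<tau> where "\<tau> q = (fst q + (n - fst p), snd q)" for q :: "nat \<times> nat"
  obtain Z' where Z': "homogeneous n m T Z'" "\<And>q. q \<in> A \<Longrightarrow> Z' (\<tau> q) = Z q"
  proof (rule homogeneous_translate[OF assms(1), of \<tau> "(real (n - fst p), 0)"])
    fix q assume "q \<in> grid n m" "Z q \<noteq> 0"
    then show "\<tau> q \<in> grid n m" "pt (\<tau> q) = pt q + (real (n - fst p), 0)"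
      using le[of q] p(1) by (auto simp: A_def \<tau>_def grid_def pt_def)
  qed (auto simp: A_def)
  moreover have "\<tau> p \<in> column m n" using p by (auto simp: A_def \<tau>_def grid_def column_def)
  moreover have "Z p \<noteq> 0" using p by (simp add: A_def)
  ultimately show ?thesis using p by metis
qed

lemma homogeneous_diff_solutions:
  assumes "X \<in> solutions n m Q" "Y \<in> solutions n m Q"
  shows "homogeneous n m (fst Q) (\<lambda>p. X p - Y p)"
  unfolding homogeneous_def
proof (intro ballI)
  fix t l assume t: "t \<in> fst Q" and l: "l \<in> lines_of_slope t"
  show "line_sum n m l (\<lambda>p. X p - Y p) = 0"
  proof (cases "l \<in> grid_lines n m t")
    case True
    then have "line_sum n m l X = line_sum n m l Y"
      using assms t by (simp add: solutions_def)
    then show ?thesis by (simp add: line_sum_def sum_subtractf)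
  next
    \<comment> \<open>The puzzle has no equation for such a line, but the sum along it is
      empty.\<close>
    case False
    then have "{p. p \<in> grid n m \<and> pt p \<in> l} = {}" using l by (auto simp: grid_lines_def)
    then show ?thesis unfolding line_sum_def by (simp only: sum.empty)
  qed
qed

text \<open>Solutions are extensional on the grid, hence the \<open>restrict\<close>; line sums read
  only grid values and are additive.\<close>

lemma solutions_add_homogeneous:
  assumes "X \<in> solutions n m Q" "homogeneous n m (fst Q) Z"
  shows "restrict (\<lambda>p. X p + Z p) (grid n m) \<in> solutions n m Q"
proof -
  have "line_sum n m l (restrict (\<lambda>p. X p + Z p) (grid n m)) = line_sum n m l X + line_sum n m l Z"
    for l by (simp add: line_sum_def flip: sum.distrib)
  then show ?thesis
    using assms by (auto simp: solutions_def homogeneous_def grid_lines_def)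
qed

text \<open>Two distinct solutions differ by a nonzero homogeneous \<open>Z\<close>. Once moved to
  meet \<open>E\<close>, it can be added to a solution to change a value on \<open>E\<close>. The
  hypothesis \<open>side\<close> abstracts the move, so one proof serves all four sides.\<close>

lemma uniquely_solvable_on_side:
  assumes Q: "solvable n m Q" and E: "E \<subseteq> grid n m"
    and side: "\<And>Z p. homogeneous n m (fst Q) Z \<Longrightarrow> p \<in> grid n m \<Longrightarrow> Z p \<noteq> 0 \<Longrightarrow>
      \<exists>Z'. homogeneous n m (fst Q) Z' \<and> (\<exists>p\<in>E. Z' p \<noteq> 0)"
  shows "uniquely_solvable_on n m Q E \<longleftrightarrow> (\<exists>!X. X \<in> solutions n m Q)"
proof
  assume u: "uniquely_solvable_on n m Q E"
  have "X p = Y p" if X: "X \<in> solutions n m Q" and Y: "Y \<in> solutions n m Q"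
    and p: "p \<in> grid n m" for X Y p
  proof (rule ccontr)
    assume "X p \<noteq> Y p"
    then obtain Z q where Z: "homogeneous n m (fst Q) Z" and q: "q \<in> E" "Z q \<noteq> 0"
      using side[OF homogeneous_diff_solutions[OF X Y] p] by auto
    \<comment> \<open>Uniqueness on \<open>E\<close> equates \<open>X\<close> with its perturbation
      at \<open>q\<close>, which contradicts \<open>Z q \<noteq> 0\<close> because \<open>q\<close>
      lies in the grid.\<close>
    have "restrict (\<lambda>p. X p + Z p) (grid n m) q = X q"
      using u solutions_add_homogeneous[OF X Z] X q unfolding uniquely_solvable_on_def by blast
    then show False using q E by auto
  qed
  then show "\<exists>!X. X \<in> solutions n m Q"
    using Q by (simp add: ex1_solution_iff uniquely_solvable_on_def)
qed (use E in \<open>auto simp: ex1_solution_iff uniquely_solvable_on_def\<close>)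

theorem theorem2:
  fixes n m :: nat
  assumes "n \<ge> 1" "m \<ge> 1"
  shows "s_inv n m = k_inv n m"
proof -
  have sub: "row n 1 \<subseteq> grid n m" "row n m \<subseteq> grid n m"
    "column m 1 \<subseteq> grid n m" "column m n \<subseteq> grid n m"
    using assms by (auto simp: row_def column_def grid_def)
  have sides:
    "uniquely_solvable_on n m Q (row n 1) \<longleftrightarrow> (\<exists>!X. X \<in> solutions n m Q)"
    "uniquely_solvable_on n m Q (row n m) \<longleftrightarrow> (\<exists>!X. X \<in> solutions n m Q)"
    "uniquely_solvable_on n m Q (column m 1) \<longleftrightarrow> (\<exists>!X. X \<in> solutions n m Q)"
    "uniquely_solvable_on n m Q (column m n) \<longleftrightarrow> (\<exists>!X. X \<in> solutions n m Q)"
    if "Q \<in> RK n m s" for Q s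
  proof -
    have Q: "solvable n m Q" using that by (simp add: RK_def)
    show "uniquely_solvable_on n m Q (row n 1) \<longleftrightarrow> (\<exists>!X. X \<in> solutions n m Q)"
      by (rule uniquely_solvable_on_side[OF Q sub(1) homogeneous_first_row])
    show "uniquely_solvable_on n m Q (row n m) \<longleftrightarrow> (\<exists>!X. X \<in> solutions n m Q)"
      by (rule uniquely_solvable_on_side[OF Q sub(2) homogeneous_last_row])
    show "uniquely_solvable_on n m Q (column m 1) \<longleftrightarrow> (\<exists>!X. X \<in> solutions n m Q)"
      by (rule uniquely_solvable_on_side[OF Q sub(3) homogeneous_first_column])
    show "uniquely_solvable_on n m Q (column m n) \<longleftrightarrow> (\<exists>!X. X \<in> solutions n m Q)"
      by (rule uniquely_solvable_on_side[OF Q sub(4) homogeneous_last_column])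
  qed
  \<comment> \<open>Both disjuncts become the uniqueness condition, so all three invariants apply
    \<open>least_slope\<close> to the same predicate.\<close>
  have "r_inv n m = k_inv n m" "c_inv n m = k_inv n m"
    unfolding r_inv_def c_inv_def k_inv_def by (simp_all only: sides disj_absorb cong: ball_cong)
  then show ?thesis by (simp add: s_inv_def min_slope_def)
qed

end
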